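(* Let $I,\mathcal{E}$, the data $\pi_I$, $P_{I\times I}$, $P_{I\times\mathcal{E}}$, $P_{\mathcal{E}\times I}=\mathbf{1}_{\mathcal{E}}\pi_I^t$, $\pi_{\mathcal{E}}$, and the irreducible $0$-$1$ matrix $L=(L(d,e):d,e\in\mathcal{E})$ be as in the context. Consider nonnegative matrices $\widehat P=(\widehat P(d,e):d,e\in\mathcal{E})$ such that $L(d,e)=0\Rightarrow\widehat P(d,e)=0$, and the constraints $$\text{(a)}\quad\forall d\in\mathcal{E}:\ \sum_{e\in L_d}\widehat P(d,e)=1;\qquad \text{(b)}\quad\forall e\in\mathcal{E}:\ \sum_{d\in L^e}\widehat\pi(d)\widehat P(d,e)=\widehat\pi(e).$$ 1. Assume that (a) and (b) are feasible, i.e. some such nonnegative $\widehat P$ satisfies them. Then the maximum entropy completion of the chain (the completion $P_{\mathcal{E}\times\mathcal{E}}=\pi(\mathcal{E})\widehat P$ maximizing the entropy $h(X)$ among all such $\widehat P$ satisfying (a) and (b)) is given by $$\widehat P(d,e)=\alpha(d)\,\beta(e)\,\mathbf{1}(e\in L_d),\qquad d,e\in\mathcal{E},$$ where $$\forall e\in\mathcal{E}:\ \beta(e)=\frac{\widehat\pi(e)}{\sum_{d\in L^e}\widehat\pi(d)\,\dfrac{1}{\sum_{c\in L_d}\beta(c)}},\qquad \forall d\in\mathcal{E}:\ \alpha(d)=\frac{1}{\sum_{e\in L_d}\beta(e)}.$$ The functions $\alpha$ and $\beta$ on $\mathcal{E}$ are strictly positive, and the matrix $\widehat P$ is irreducible.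 2. Moreover, the condition $L(d,d)=1$ for all $d\in\mathcal{E}$ is sufficient for (a) and (b) to be feasible, i.e. under it there always exists a nonnegative matrix $\widehat P$ with $L(d,e)=0\Rightarrow\widehat P(d,e)=0$ satisfying (a) and (b).
   Context: Setting. $I$ and $\mathcal{E}$ are disjoint nonempty finite sets. $X=(X_n:n\in\mathbb{Z})$ is an irreducible stationary Markov chain on $I\sqcup\mathcal{E}$ with transition matrix $P$ and stationary distribution $\pi$, $\pi^tP=\pi^t$ (so $\pi>0$). For $J,K\subseteq I\sqcup\mathcal{E}$, $P_{J\times K}=(P(a,b):a\in J,b\in K)$; $\pi_I,\pi_{\mathcal{E}}$ are the restrictions of $\pi$; $\pi(A)=\sum_{a\in A}\pi(a)$; $\mathbf{1}_{\mathcal{E}}$ is the column vector of ones indexed by $\mathcal{E}$; vectors are columns. The matrix $P_{I\times I}$ is irreducible, and there is some $i\in I$ with $P(i,\mathcal{E})=\sum_{d\in\mathcal{E}}P(i,d)>0$. Hypotheses on the chain: (i) $P_{\mathcal{E}\times I}=\mathbf{1}_{\mathcal{E}}\pi_I^t$; (ii) $\pi(\mathcal{E})\pi_{\mathcal{E}}^t=\pi_{\mathcal{E}}^tP_{\mathcal{E}\times\mathcal{E}}$. These imply $P_{\mathcal{E}\times\mathcal{E}}\mathbf{1}_{\mathcal{E}}=\pi(\mathcal{E})\mathbf{1}_{\mathcal{E}}$ and $\pi_{\mathcal{E}}^t=\pi(I)^{-1}\pi_I^tP_{I\times\mathcal{E}}$. The quantities $\pi_I$, $P_{I\times I}$, $P_{I\times\mathcal{E}}$,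 $P_{\mathcal{E}\times I}$ (hence $\pi_{\mathcal{E}}$) are known and fixed, while the block $P_{\mathcal{E}\times\mathcal{E}}$ is unknown; a completion is a choice of this block. Write $\widehat P=\pi(\mathcal{E})^{-1}P_{\mathcal{E}\times\mathcal{E}}$ and $\widehat\pi(d)=\pi(d)/\pi(\mathcal{E})$ for $d\in\mathcal{E}$, a strictly positive probability vector on $\mathcal{E}$. The entropy of the completed stationary chain is $h(X)=-\sum_{a\in I\sqcup\mathcal{E}}\pi(a)\sum_{b\in I\sqcup\mathcal{E}}P(a,b)\log P(a,b)$ with $0\log0=0$; maximizing it over completions is equivalent to maximizing $-\sum_{d\in\mathcal{E}}\widehat\pi(d)\sum_{e\in L_d}\widehat P(d,e)\log\widehat P(d,e)$. Communication matrix. $L=(L(d,e):d,e\in\mathcal{E})$ is a given $0$-$1$ matrix, assumed irreducible: for all $d,e\in\mathcal{E}$ there is a path $d_0=d,\dots,d_k=e$ with $L(d_i,d_{i+1})=1$ for $i=0,\dots,k-1$. For $d\in\mathcal{E}$, $L_d=\{e\in\mathcal{E}:L(d,e)=1\}$ and $L^d=\{e\in\mathcal{E}:L(e,d)=1\}$.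
   Formalization: Part 1 fails under feasibility alone (L = (1 1; 1 0), uniform π̂); the formal version proves a unique maximizer exists and has the stated form and irreducibility iff some feasible P̂ is positive wherever L = 1; part 2 also yields such a P̂. *)

theory Defs
  imports Complex_Main
begin

text \<open>Square matrices indexed by a finite type are functions of two arguments. The state space
  \<open>I \<squnion> \<E>\<close> is the sum type \<open>'i + 'e\<close>, with \<open>I = range Inl\<close> and \<open>\<E> = range Inr\<close>.\<close>

definition stochastic :: "('a::finite \<Rightarrow> 'a \<Rightarrow> real) \<Rightarrow> bool" where
  "stochastic P \<longleftrightarrow> (\<forall>a b. 0 \<le> P a b) \<and> (\<forall>a. (\<Sum>b\<in>UNIV. P a b) = 1)"

definition stationary_distribution :: "('a::finite \<Rightarrow> 'a \<Rightarrow> real) \<Rightarrow> ('a \<Rightarrow> real) \<Rightarrow> bool" where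
  "stationary_distribution P \<pi> \<longleftrightarrow>
     (\<forall>a. 0 \<le> \<pi> a) \<and> (\<Sum>a\<in>UNIV. \<pi> a) = 1 \<and> (\<forall>b. (\<Sum>a\<in>UNIV. \<pi> a * P a b) = \<pi> b)"

text \<open>Paths of length 0 are allowed, so a one-by-one matrix always counts as irreducible.\<close>

definition irreducible_mat :: "('a \<Rightarrow> 'a \<Rightarrow> real) \<Rightarrow> bool" where
  "irreducible_mat M \<longleftrightarrow> (\<forall>a b. (\<lambda>x y. 0 < M x y)\<^sup>*\<^sup>* a b)"

text \<open>Entropy of the stationary chain; \<open>ln 0 = 0\<close> makes the convention \<open>0 log 0 = 0\<close> automatic.\<close>

definition chain_entropy :: "('a::finite \<Rightarrow> real) \<Rightarrow> ('a \<Rightarrow> 'a \<Rightarrow> real) \<Rightarrow> real" where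
  "chain_entropy \<pi> P = - (\<Sum>a\<in>UNIV. \<pi> a * (\<Sum>b\<in>UNIV. P a b * ln (P a b)))"

definition mass_E :: "('i::finite + 'e::finite \<Rightarrow> real) \<Rightarrow> real" where
  "mass_E \<pi> = (\<Sum>d\<in>UNIV. \<pi> (Inr d))"

definition pi_hat :: "('i::finite + 'e::finite \<Rightarrow> real) \<Rightarrow> 'e \<Rightarrow> real" where
  "pi_hat \<pi> d = \<pi> (Inr d) / mass_E \<pi>"

text \<open>The completion keeps every entry of \<open>P\<close> outside the \<open>\<E> \<times> \<E>\<close> block; the block itself is
  discarded and replaced by \<open>\<pi>(\<E>) Q\<close>.\<close>

fun completion ::
  "('i::finite + 'e::finite \<Rightarrow> real) \<Rightarrow> ('i + 'e \<Rightarrow> 'i + 'e \<Rightarrow> real) \<Rightarrow> ('e \<Rightarrow> 'e \<Rightarrow> real)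
     \<Rightarrow> 'i + 'e \<Rightarrow> 'i + 'e \<Rightarrow> real" where
  "completion \<pi> P Q (Inr d) (Inr e) = mass_E \<pi> * Q d e"
| "completion \<pi> P Q (Inl i) b = P (Inl i) b"
| "completion \<pi> P Q (Inr d) (Inl i) = P (Inr d) (Inl i)"

definition row_supp :: "('e \<Rightarrow> 'e \<Rightarrow> real) \<Rightarrow> 'e \<Rightarrow> 'e set" where
  "row_supp L d = {e. L d e = 1}"

definition col_supp :: "('e \<Rightarrow> 'e \<Rightarrow> real) \<Rightarrow> 'e \<Rightarrow> 'e set" where
  "col_supp L e = {d. L d e = 1}"

definition admissible :: "('e::finite \<Rightarrow> 'e \<Rightarrow> real) \<Rightarrow> ('e \<Rightarrow> real) \<Rightarrow> ('e \<Rightarrow> 'e \<Rightarrow> real) \<Rightarrow> bool" where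
  "admissible L p Q \<longleftrightarrow>
     (\<forall>d e. 0 \<le> Q d e) \<and>
     (\<forall>d e. L d e = 0 \<longrightarrow> Q d e = 0) \<and>
     (\<forall>d. (\<Sum>e\<in>row_supp L d. Q d e) = 1) \<and>
     (\<forall>e. (\<Sum>d\<in>col_supp L e. p d * Q d e) = p e)"

definition feasible :: "('e::finite \<Rightarrow> 'e \<Rightarrow> real) \<Rightarrow> ('e \<Rightarrow> real) \<Rightarrow> bool" where
  "feasible L p \<longleftrightarrow> (\<exists>Q. admissible L p Q)"

text \<open>Feasibility with no entry allowed by \<open>L\<close> forced to vanish. This is strictly stronger than
  \<open>feasible\<close>, even for irreducible \<open>L\<close>: for \<open>L = (1 1; 1 0)\<close> and \<open>p = (1/2, 1/2)\<close> the only
  admissible matrix is the swap \<open>(0 1; 1 0)\<close>, which is not of the form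
  \<open>\<alpha>(d) \<beta>(e) 1(L(d,e) = 1)\<close>.\<close>

definition fully_feasible :: "('e::finite \<Rightarrow> 'e \<Rightarrow> real) \<Rightarrow> ('e \<Rightarrow> real) \<Rightarrow> bool" where
  "fully_feasible L p \<longleftrightarrow> (\<exists>Q. admissible L p Q \<and> (\<forall>d e. L d e = 1 \<longrightarrow> 0 < Q d e))"

definition max_entropy_completion ::
  "('i::finite + 'e::finite \<Rightarrow> real) \<Rightarrow> ('i + 'e \<Rightarrow> 'i + 'e \<Rightarrow> real) \<Rightarrow> ('e \<Rightarrow> 'e \<Rightarrow> real)
     \<Rightarrow> ('e \<Rightarrow> 'e \<Rightarrow> real) \<Rightarrow> bool" where
  "max_entropy_completion \<pi> P L Q \<longleftrightarrow>
     is_arg_max (\<lambda>R. chain_entropy \<pi> (completion \<pi> P R)) (admissible L (pi_hat \<pi>)) Q"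

end

theory Submission
  imports Defs "HOL-Analysis.Cartesian_Euclidean_Space" "HOL-Real_Asymp.Real_Asymp"
begin

text \<open>The known blocks contribute a constant to the entropy of a completion, so one maximises the
  strictly concave continuous function \<open>weighted_entropy\<close> over a compact convex set, which gives a
  unique maximiser \<open>Q\<close>. If some feasible matrix is positive wherever \<open>L\<close> is, then so is \<open>Q\<close>, because
  the slope of \<open>- x ln x\<close> at \<open>0\<close> is infinite. Then \<open>Q\<close> lies in the relative interior and Lagrange
  multipliers give \<open>ln Q(d,e) = a(d) + b(e)\<close> on the support of \<open>L\<close>; the equations for \<open>\<alpha> = exp a\<close> and
  \<open>\<beta> = exp b\<close> are the two marginal constraints. When \<open>L\<close> has full diagonal, adding a small multiple of
  a positive circulation along \<open>L\<close> to the diagonal solution gives a feasible matrix of full support.\<close>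

section \<open>Convexity and continuity of \<open>x * ln x\<close> on the half-line\<close>

text \<open>The left side is the tangent to \<open>x * ln x\<close> at \<open>m\<close>. For
  \<open>x > 0\<close> the gap is \<open>x\<close> times \<open>y - 1 - ln y\<close> at
  \<open>y = m / x\<close>, which vanishes only at \<open>y = 1\<close>; for \<open>x = 0\<close>
  the gap is \<open>m\<close>.\<close>

lemma mult_ln_tangent:
  fixes x m :: real
  assumes "0 \<le> x" "0 < m"
  shows "x * (ln m + 1) - m \<le> x * ln x"
    and "x \<noteq> m \<Longrightarrow> x * (ln m + 1) - m < x * ln x"
proof -
  consider "x = 0" | "0 < x" using assms by linarith
  then have "x * (ln m + 1) - m \<le> x * ln x \<and> (x \<noteq> m \<longrightarrow> x * (ln m + 1) - m < x * ln x)"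
  proof cases
    case 2
    have le: "ln (m / x) \<le> m / x - 1" using 2 assms by (intro ln_le_minus_one) auto
    have ne: "ln (m / x) \<noteq> m / x - 1" if "x \<noteq> m"
      using that 2 assms ln_eq_minus_one[of "m / x"] by auto
    have eq: "x * ln x - (x * (ln m + 1) - m) = x * (m / x - 1 - ln (m / x))"
      using 2 assms by (simp add: ln_div field_simps)
    have "0 \<le> x * (m / x - 1 - ln (m / x))" using le 2 by (intro mult_nonneg_nonneg) auto
    moreover have "0 < x * (m / x - 1 - ln (m / x))" if "x \<noteq> m"
      using le ne[OF that] 2 by (intro mult_pos_pos) auto
    ultimately show ?thesis using eq by (metis diff_ge_0_iff_ge diff_gt_0_iff_gt)
  qed (use assms in auto)
  then show "x * (ln m + 1) - m \<le> x * ln x"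
    and "x \<noteq> m \<Longrightarrow> x * (ln m + 1) - m < x * ln x" by auto
qed

text \<open>Average the tangent inequalities at \<open>m\<close> for \<open>x\<close> and
  \<open>y\<close>: the tangent values average to \<open>m * ln m\<close>. If \<open>x\<close> and
  \<open>y\<close> differ, then \<open>m\<close> differs from \<open>x\<close>, and strictness in
  that one inequality is enough. There is no tangent at \<open>m = 0\<close>, but then
  \<open>x\<close> and \<open>y\<close> both vanish.\<close>

lemma mult_ln_convex:
  fixes x y t :: real
  assumes "0 \<le> x" "0 \<le> y" "0 < t" "t < 1"
  defines "m \<equiv> (1 - t) * x + t * y"
  shows "m * ln m \<le> (1 - t) * (x * ln x) + t * (y * ln y)"
    and "x \<noteq> y \<Longrightarrow> m * ln m < (1 - t) * (x * ln x) + t * (y * ln y)"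
proof -
  have m0: "0 \<le> m" using assms by simp
  have "m * ln m \<le> (1 - t) * (x * ln x) + t * (y * ln y) \<and>
    (x \<noteq> y \<longrightarrow> m * ln m < (1 - t) * (x * ln x) + t * (y * ln y))"
  proof (cases "m = 0")
    case True
    then have "x = 0 \<and> y = 0"
      using assms by (simp add: add_nonneg_eq_0_iff)
    then show ?thesis by (simp add: m_def)
  next
    case False
    then have m: "0 < m" using m0 by simp
    have eq: "m * ln m = (1 - t) * (x * (ln m + 1) - m) + t * (y * (ln m + 1) - m)"
      unfolding m_def by algebra
    have 1: "(1 - t) * (x * (ln m + 1) - m) \<le> (1 - t) * (x * ln x)"
      using mult_ln_tangent(1)[OF assms(1) m] assms(4) by (intro mult_left_mono) auto
    have 2: "t * (y * (ln m + 1) - m) \<le> t * (y * ln y)"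
      using mult_ln_tangent(1)[OF assms(2) m] assms(3) by (intro mult_left_mono) auto
    have 3: "(1 - t) * (x * (ln m + 1) - m) < (1 - t) * (x * ln x)" if "x \<noteq> y"
    proof -
      have "m - x = t * (y - x)" unfolding m_def by algebra
      then have "x \<noteq> m" using that assms(3) by auto
      then show ?thesis
        using mult_ln_tangent(2)[OF assms(1) m] assms(4) by (intro mult_strict_left_mono) auto
    qed
    show ?thesis using eq 1 2 3 by force
  qed
  then show "m * ln m \<le> (1 - t) * (x * ln x) + t * (y * ln y)"
    and "x \<noteq> y \<Longrightarrow> m * ln m < (1 - t) * (x * ln x) + t * (y * ln y)" by auto
qed

lemma continuous_on_mult_ln: "continuous_on {0..} (\<lambda>x::real. x * ln x)"
  unfolding continuous_on_eq_continuous_within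
proof
  fix x :: real assume "x \<in> {0..}"
  then consider "x = 0" | "0 < x" by fastforce
  then show "continuous (at x within {0..}) (\<lambda>x. x * ln x)"
  proof cases
    case 1
    have "((\<lambda>x::real. x * ln x) \<longlongrightarrow> 0) (at_right 0)" by real_asymp
    moreover have "at (0::real) within {0..} = at_right 0"
      by (rule at_within_nhd[of _ UNIV]) auto
    ultimately show ?thesis using 1 by (simp add: continuous_within)
  next
    case 2
    then have "isCont (\<lambda>x. x * ln x) x" by (intro continuous_intros) auto
    then show ?thesis by (rule continuous_at_imp_continuous_at_within)
  qed
qed

section \<open>Weighted entropy of matrices with prescribed support and marginals\<close>

text \<open>The inner sum runs over all \<open>e\<close>; for admissible matrices this agrees with
  the sum over the support of the row, since vanishing entries contribute
  \<open>0 * ln 0 = 0\<close>.\<close>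

definition weighted_entropy :: "('e::finite \<Rightarrow> real) \<Rightarrow> ('e \<Rightarrow> 'e \<Rightarrow> real) \<Rightarrow> real" where
  "weighted_entropy p Q = - (\<Sum>d\<in>UNIV. \<Sum>e\<in>UNIV. p d * (Q d e * ln (Q d e)))"

locale support_pattern =
  fixes L :: "'e::finite \<Rightarrow> 'e \<Rightarrow> real" and p :: "'e \<Rightarrow> real"
  assumes L_01: "L d e = 0 \<or> L d e = 1"
    and p_pos: "0 < p d"
begin

text \<open>Entries outside the support vanish, so the marginal sums may run over the whole type,
  which makes all constraints linear in a uniform way. If the support condition fails, both sides
  are false.\<close>

lemma adm_iff:
  "admissible L p Q \<longleftrightarrow>
     (\<forall>d e. 0 \<le> Q d e) \<and> (\<forall>d e. L d e = 0 \<longrightarrow> Q d e = 0) \<and>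
     (\<forall>d. (\<Sum>e\<in>UNIV. Q d e) = 1) \<and> (\<forall>e. (\<Sum>d\<in>UNIV. p d * Q d e) = p e)"
proof (cases "\<forall>d e. L d e = 0 \<longrightarrow> Q d e = 0")
  case True
  have "(\<Sum>e\<in>row_supp L d. Q d e) = (\<Sum>e\<in>UNIV. Q d e)" for d
    using True L_01 by (intro sum.mono_neutral_left) (auto simp: row_supp_def)
  moreover have "(\<Sum>d\<in>col_supp L e. p d * Q d e) = (\<Sum>d\<in>UNIV. p d * Q d e)" for e
    using True L_01 by (intro sum.mono_neutral_left) (auto simp: col_supp_def)
  ultimately show ?thesis by (simp add: admissible_def)
qed (auto simp: admissible_def)

lemma adm_mix:
  assumes "admissible L p Q" "admissible L p R" "0 < t" "t < 1"
  shows "admissible L p (\<lambda>d e. (1 - t) * Q d e + t * R d e)"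
proof -
  have eq: "p d * ((1 - t) * Q d e + t * R d e) = (1 - t) * (p d * Q d e) + t * (p d * R d e)" for d e
    by algebra
  show ?thesis
    using assms unfolding adm_iff
    by (simp add: eq sum.distrib flip: sum_distrib_left) (simp add: algebra_simps)
qed

text \<open>Convexity of \<open>x * ln x\<close> is summed over all entries. As every weight
  \<open>p d\<close> is positive, one entry where the matrices differ makes the sum strict.\<close>

lemma entropy_strict_concave:
  assumes "admissible L p Q" "admissible L p R" "Q \<noteq> R" "0 < t" "t < 1"
  shows "(1 - t) * weighted_entropy p Q + t * weighted_entropy p R
    < weighted_entropy p (\<lambda>d e. (1 - t) * Q d e + t * R d e)"
proof -
  let ?m = "\<lambda>d e. (1 - t) * Q d e + t * R d e"
  let ?F = "\<lambda>d e. p d * ((1 - t) * (Q d e * ln (Q d e)) + t * (R d e * ln (R d e)))"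
  have nn: "0 \<le> Q d e" "0 \<le> R d e" for d e using assms by (auto simp: adm_iff)
  have le: "p d * (?m d e * ln (?m d e)) \<le> ?F d e" for d e
    using mult_ln_convex(1)[OF nn assms(4,5)] p_pos[of d] by (intro mult_left_mono) auto
  obtain a b where ab: "Q a b \<noteq> R a b" using assms(3) by (metis ext)
  have lt: "p a * (?m a b * ln (?m a b)) < ?F a b"
    using mult_ln_convex(2)[OF nn assms(4,5) ab] p_pos[of a] by (intro mult_strict_left_mono) auto
  have "(\<Sum>d\<in>UNIV. \<Sum>e\<in>UNIV. p d * (?m d e * ln (?m d e))) < (\<Sum>d\<in>UNIV. \<Sum>e\<in>UNIV. ?F d e)"
    by (rule sum_strict_mono_ex1)
      (use le lt in \<open>auto intro!: sum_mono bexI[of _ a] sum_strict_mono_ex1 bexI[of _ b]\<close>)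
  also have "\<dots> = - ((1 - t) * weighted_entropy p Q + t * weighted_entropy p R)"
    by (simp add: weighted_entropy_def sum_distrib_left sum.distrib algebra_simps sum_subtractf)
  finally show ?thesis by (simp add: weighted_entropy_def)
qed

lemma adm_le_1:
  assumes "admissible L p Q"
  shows "Q d e \<le> 1"
proof -
  have "Q d e \<le> (\<Sum>e\<in>UNIV. Q d e)"
    using assms by (intro member_le_sum) (auto simp: adm_iff)
  then show ?thesis using assms by (simp add: adm_iff)
qed

lemma ex1_entropy_max:
  assumes "feasible L p"
  shows "\<exists>!Q. is_arg_max (weighted_entropy p) (admissible L p) Q"
proof (rule ex_ex1I)
  note [simp] = vec_lambda_inverse[OF UNIV_I]
  \<comment> \<open>Matrices are moved to \<open>real^'e^'e\<close>, where closed and bounded sets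
    are compact.\<close>
  define S where "S = {x :: real^'e^'e. admissible L p (\<lambda>d e. x $ d $ e)}"
  have "closed S"
  proof -
    \<comment> \<open>The factor \<open>of_bool (L d e = 0)\<close> turns the conditional support
      constraint into an equation between continuous functions.\<close>
    have "S = (\<Inter>d. \<Inter>e. {x. 0 \<le> x $ d $ e}) \<inter> (\<Inter>d. \<Inter>e. {x. of_bool (L d e = 0) * x $ d $ e = 0})
      \<inter> (\<Inter>d. {x. (\<Sum>e\<in>UNIV. x $ d $ e) = 1}) \<inter> (\<Inter>e. {x. (\<Sum>d\<in>UNIV. p d * x $ d $ e) = p e})"
      by (auto simp: S_def adm_iff)
    moreover have "closed {x :: real^'e^'e. 0 \<le> x $ d $ e}" for d e
      by (intro closed_Collect_le continuous_intros)
    moreover have "closed {x :: real^'e^'e. of_bool (L d e = 0) * x $ d $ e = 0}" for d e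
      by (intro closed_Collect_eq continuous_intros)
    moreover have "closed {x :: real^'e^'e. (\<Sum>e\<in>UNIV. x $ d $ e) = 1}" for d
      by (intro closed_Collect_eq continuous_intros)
    moreover have "closed {x :: real^'e^'e. (\<Sum>d\<in>UNIV. p d * x $ d $ e) = p e}" for e
      by (intro closed_Collect_eq continuous_intros)
    ultimately show ?thesis by (simp only:) (intro closed_Int closed_INT ballI)
  qed
  moreover have "bounded S"
  proof (rule boundedI)
    fix x assume "x \<in> S"
    then have "\<bar>x $ d $ e\<bar> \<le> 1" for d e
      using adm_le_1[of "\<lambda>d e. x $ d $ e" d e] by (auto simp: S_def adm_iff)
    then have "norm (x $ d) \<le> (\<Sum>e\<in>(UNIV::'e set). 1)" for d
      by (intro order.trans[OF norm_le_l1_cart] sum_mono) auto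
    then have "(\<Sum>d\<in>UNIV. norm (x $ d)) \<le> (\<Sum>d\<in>(UNIV::'e set). \<Sum>e\<in>(UNIV::'e set). 1)"
      by (intro sum_mono) auto
    then show "norm x \<le> (\<Sum>d\<in>(UNIV::'e set). \<Sum>e\<in>(UNIV::'e set). 1)"
      using L2_set_le_sum[of UNIV "\<lambda>d. norm (x $ d)"] by (simp add: norm_vec_def)
  qed
  ultimately have "compact S" by (simp add: compact_eq_bounded_closed)
  moreover have "S \<noteq> {}"
  proof -
    obtain Q where "admissible L p Q" using assms by (auto simp: feasible_def)
    then have "(\<chi> d e. Q d e) \<in> S" by (simp add: S_def)
    then show ?thesis by auto
  qed
  moreover have "continuous_on S (\<lambda>x. weighted_entropy p (\<lambda>d e. x $ d $ e))"
    unfolding weighted_entropy_def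
    by (intro continuous_intros continuous_on_compose2[OF continuous_on_mult_ln])
      (auto simp: S_def adm_iff)
  ultimately obtain x where x: "x \<in> S"
    "\<And>y. y \<in> S \<Longrightarrow> weighted_entropy p (\<lambda>d e. y $ d $ e) \<le> weighted_entropy p (\<lambda>d e. x $ d $ e)"
    using continuous_attains_sup[of S "\<lambda>x. weighted_entropy p (\<lambda>d e. x $ d $ e)"] by blast
  have "weighted_entropy p R \<le> weighted_entropy p (\<lambda>d e. x $ d $ e)" if "admissible L p R" for R
    using x(2)[of "\<chi> d e. R d e"] that by (simp add: S_def)
  then show "\<exists>Q. is_arg_max (weighted_entropy p) (admissible L p) Q"
    using x(1) by (force simp: is_arg_max_def S_def not_less)
next
  fix Q R
  assume "is_arg_max (weighted_entropy p) (admissible L p) Q"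
    "is_arg_max (weighted_entropy p) (admissible L p) R"
  then have adm: "admissible L p Q" "admissible L p R"
    and max: "\<And>A. admissible L p A \<Longrightarrow> weighted_entropy p A \<le> weighted_entropy p Q"
      "weighted_entropy p R = weighted_entropy p Q"
    by (force simp: is_arg_max_def not_less)+
  show "Q = R"
  proof (rule ccontr)
    \<comment> \<open>The midpoint of two distinct maximisers would be admissible with larger
      entropy.\<close>
    assume "Q \<noteq> R"
    from entropy_strict_concave[OF adm this, of "1/2"] max(1)[OF adm_mix[OF adm, of "1/2"]] max(2)
    show False by simp
  qed
qed

text \<open>The entropy has infinite slope at a vanishing entry, so moving from the maximiser towards a
  fully supported matrix would increase it.\<close>

lemma entropy_max_pos:
  assumes max: "is_arg_max (weighted_entropy p) (admissible L p) Q"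
    and full: "fully_feasible L p" and ab: "L a b = 1"
  shows "0 < Q a b"
proof (rule ccontr)
  assume "\<not> 0 < Q a b"
  have admQ: "admissible L p Q" using max by (simp add: is_arg_max_def)
  then have Q0: "Q a b = 0" using \<open>\<not> 0 < Q a b\<close> by (auto simp: adm_iff not_less intro: antisym)
  obtain R where R: "admissible L p R" and Rpos: "\<And>d e. L d e = 1 \<Longrightarrow> 0 < R d e"
    using full by (auto simp: fully_feasible_def)
  define r where "r = p a * R a b"
  have r: "0 < r" using Rpos[OF ab] p_pos[of a] by (simp add: r_def)
  \<comment> \<open>Chosen so that \<open>r * ln t\<close> lies below the entropy difference between
    \<open>R\<close> and \<open>Q\<close>; the \<open>- 1\<close> makes this strict and
    \<open>1/2\<close> keeps \<open>t\<close> below 1.\<close>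
  define t where "t = min (1/2) (exp ((weighted_entropy p R - weighted_entropy p Q) / r - 1))"
  have t: "0 < t" "t < 1" by (auto simp: t_def)
  have "ln t \<le> (weighted_entropy p R - weighted_entropy p Q) / r - 1"
  proof -
    have "ln t \<le> ln (exp ((weighted_entropy p R - weighted_entropy p Q) / r - 1))"
      using t(1) by (intro ln_mono) (auto simp: t_def)
    then show ?thesis by simp
  qed
  then have lnt: "r * ln t < weighted_entropy p R - weighted_entropy p Q"
    using r by (simp add: field_simps)
  let ?m = "\<lambda>d e. (1 - t) * Q d e + t * R d e"
  let ?F = "\<lambda>d e. p d * ((1 - t) * (Q d e * ln (Q d e)) + t * (R d e * ln (R d e)))"
  have nn: "0 \<le> Q d e" "0 \<le> R d e" for d e using admQ R by (auto simp: adm_iff)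
  have le: "p d * (?m d e * ln (?m d e)) \<le> ?F d e" for d e
    using mult_ln_convex(1)[OF nn t] p_pos[of d] by (intro mult_left_mono) auto
  \<comment> \<open>Here the mixture is \<open>t * R a b\<close>, and splitting its logarithm leaves
    the extra term \<open>r * t * ln t\<close>. This yields a gain of order
    \<open>- t * ln t\<close>, which beats any linear loss.\<close>
  have eq: "p a * (?m a b * ln (?m a b)) = ?F a b + r * t * ln t"
    using Q0 t(1) Rpos[OF ab] by (simp add: r_def ln_mult algebra_simps)
  have bound: "p d * (?m d e * ln (?m d e)) \<le> ?F d e + of_bool (d = a \<and> e = b) * (r * t * ln t)" for d e
    using le[of d e] eq by (cases "d = a \<and> e = b") auto
  have "(\<Sum>d\<in>UNIV. \<Sum>e\<in>UNIV. p d * (?m d e * ln (?m d e)))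
     \<le> (\<Sum>d\<in>UNIV. \<Sum>e\<in>UNIV. ?F d e + of_bool (d = a \<and> e = b) * (r * t * ln t))"
    by (intro sum_mono bound)
  also have "\<dots> = (\<Sum>d\<in>UNIV. \<Sum>e\<in>UNIV. ?F d e) + r * t * ln t"
    by (simp add: sum.distrib of_bool_conj flip: sum_distrib_left sum_distrib_right)
  also have "(\<Sum>d\<in>UNIV. \<Sum>e\<in>UNIV. ?F d e) = - ((1 - t) * weighted_entropy p Q + t * weighted_entropy p R)"
    by (simp add: weighted_entropy_def sum_distrib_left sum.distrib algebra_simps sum_subtractf)
  finally have "(1 - t) * weighted_entropy p Q + t * weighted_entropy p R - r * t * ln t \<le> weighted_entropy p ?m"
    by (simp add: weighted_entropy_def)
  moreover have "t * (r * ln t) < t * (weighted_entropy p R - weighted_entropy p Q)"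
    using lnt t(1) by simp
  ultimately have "weighted_entropy p Q < weighted_entropy p ?m"
    by (simp add: algebra_simps)
  then show False
    using max adm_mix[OF admQ R t] by (force simp: is_arg_max_def)
qed

text \<open>\<open>D\<close> is a direction preserving support and marginals. Since \<open>Q\<close>
  is positive on the support, \<open>Q + t D\<close> stays admissible for small \<open>t\<close> of
  either sign, so the derivative of the entropy at \<open>t = 0\<close> vanishes.\<close>

lemma entropy_max_stationary:
  assumes max: "is_arg_max (weighted_entropy p) (admissible L p) Q"
    and pos: "\<And>d e. L d e = 1 \<Longrightarrow> 0 < Q d e"
    and supp: "\<And>d e. L d e = 0 \<Longrightarrow> D d e = 0"
    and row: "\<And>d. (\<Sum>e\<in>UNIV. D d e) = 0"
    and col: "\<And>e. (\<Sum>d\<in>UNIV. p d * D d e) = 0"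
  shows "(\<Sum>d\<in>UNIV. \<Sum>e\<in>UNIV. p d * D d e * ln (Q d e)) = 0"
proof -
  have admQ: "admissible L p Q" using max by (simp add: is_arg_max_def)
  define G where "G t = (\<lambda>d e. Q d e + t * D d e)" for t
  have "\<forall>\<^sub>F t in nhds 0. 0 \<le> G t d e" for d e
  proof (cases "L d e = 0")
    case True
    then show ?thesis using supp admQ by (simp add: G_def adm_iff)
  next
    case False
    then have "0 < Q d e" using pos L_01 by blast
    moreover have "((\<lambda>t. G t d e) \<longlongrightarrow> Q d e) (nhds 0)"
      unfolding G_def by (rule tendsto_eq_intros refl filterlim_ident)+ simp
    ultimately have "\<forall>\<^sub>F t in nhds 0. 0 < G t d e" by (simp add: order_tendstoD)
    then show ?thesis by (rule eventually_mono) simp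
  qed
  then have "\<forall>\<^sub>F t in nhds 0. \<forall>d e. 0 \<le> G t d e"
    by (simp add: eventually_all_finite)
  then have "\<forall>\<^sub>F t in nhds 0. admissible L p (G t)"
  proof (rule eventually_mono)
    fix t assume "\<forall>d e. 0 \<le> G t d e"
    moreover have "(\<Sum>d\<in>UNIV. p d * (t * D d e)) = t * (\<Sum>d\<in>UNIV. p d * D d e)" for e
      by (simp add: sum_distrib_left algebra_simps)
    ultimately show "admissible L p (G t)"
      using admQ supp row col
      by (simp add: adm_iff G_def sum.distrib distrib_left flip: sum_distrib_left)
  qed
  then obtain \<delta> where \<delta>: "0 < \<delta>" "\<And>t. \<bar>t\<bar> < \<delta> \<Longrightarrow> admissible L p (G t)"
    by (auto simp: eventually_nhds_metric dist_real_def)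
  \<comment> \<open>The derivative of \<open>x * ln x\<close> is \<open>ln x + 1\<close>; the
    contribution of the 1 disappears at the end because the rows of \<open>D\<close> sum to
    zero.\<close>
  have entry: "((\<lambda>t. p d * (G t d e * ln (G t d e))) has_real_derivative
      p d * D d e * ln (Q d e) + p d * D d e) (at 0)" for d e
  proof (cases "L d e = 0")
    case True
    then show ?thesis using supp by (simp add: G_def)
  next
    case False
    then have "0 < Q d e" using pos L_01 by blast
    then show ?thesis
      unfolding G_def by (auto intro!: derivative_eq_intros simp: field_simps)
  qed
  have "((\<lambda>t. weighted_entropy p (G t)) has_real_derivative
      - (\<Sum>d\<in>UNIV. \<Sum>e\<in>UNIV. p d * D d e * ln (Q d e) + p d * D d e)) (at 0)"
    unfolding weighted_entropy_def by (intro DERIV_minus DERIV_sum entry)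
  moreover have "weighted_entropy p (G t) \<le> weighted_entropy p (G 0)" if "\<bar>0 - t\<bar> < \<delta>" for t
    using max \<delta>(2)[of t] that by (simp add: is_arg_max_def G_def not_less)
  ultimately have "- (\<Sum>d\<in>UNIV. \<Sum>e\<in>UNIV. p d * D d e * ln (Q d e) + p d * D d e) = 0"
    using DERIV_local_max \<delta>(1) by blast
  then show ?thesis
    using row by (simp add: sum.distrib flip: sum_distrib_left)
qed

text \<open>Lagrange multipliers: \<open>ln Q\<close>, masked by \<open>L\<close>, equals its orthogonal projection onto the
  subspace of the matrices \<open>L(d,e) (a(d) + b(e))\<close>.\<close>

lemma entropy_max_product_form:
  assumes max: "is_arg_max (weighted_entropy p) (admissible L p) Q"
    and pos: "\<And>d e. L d e = 1 \<Longrightarrow> 0 < Q d e"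
  obtains a b where "\<And>d e. L d e = 1 \<Longrightarrow> ln (Q d e) = a d + b e"
proof -
  define U where "U = {x :: real^'e^'e. \<exists>a b. \<forall>d e. x $ d $ e = L d e * (a d + b e)}"
  have U: "subspace U"
    unfolding subspace_def
  proof (intro conjI ballI allI)
    show "0 \<in> U" unfolding U_def
      by (auto intro!: exI[of _ "\<lambda>_. 0"])
    show "x + y \<in> U" if xy: "x \<in> U" "y \<in> U" for x y
    proof -
      obtain a b a' b' where "\<forall>d e. x $ d $ e = L d e * (a d + b e)" "\<forall>d e. y $ d $ e = L d e * (a' d + b' e)"
        using xy by (auto simp: U_def)
      then show ?thesis unfolding U_def
        by (intro CollectI exI[of _ "\<lambda>d. a d + a' d"] exI[of _ "\<lambda>d. b d + b' d"] allI, simp add: algebra_simps)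
    qed
    show "c *\<^sub>R x \<in> U" if x: "x \<in> U" for c x
    proof -
      obtain a b where "\<forall>d e. x $ d $ e = L d e * (a d + b e)"
        using x by (auto simp: U_def)
      then show ?thesis unfolding U_def
        by (intro CollectI exI[of _ "\<lambda>d. c * a d"] exI[of _ "\<lambda>d. c * b d"] allI, simp add: algebra_simps)
    qed
  qed
  define w :: "real^'e^'e" where "w = (\<chi> d e. L d e * ln (Q d e))"
  obtain u z where u: "u \<in> span U" and z: "\<And>x. x \<in> span U \<Longrightarrow> orthogonal z x" and w: "w = u + z"
    using orthogonal_subspace_decomp_exists[of U w] by metis
  have uU: "u \<in> U" using u U by (metis span_eq_iff)
  have ortho: "(\<Sum>d\<in>UNIV. \<Sum>e\<in>UNIV. z $ d $ e * (L d e * (a d + b e))) = 0" for a b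
  proof -
    have "(\<chi> d e. L d e * (a d + b e)) \<in> span U" by (intro span_base) (auto simp: U_def)
    from z[OF this] show ?thesis by (simp add: orthogonal_def inner_vec_def)
  qed
  have zL: "z $ d $ e = 0" if "L d e = 0" for d e
  proof -
    have "w $ d $ e = 0" "u $ d $ e = 0" using that uU by (auto simp: w_def U_def)
    then show ?thesis using w by simp
  qed
  then have mask: "z $ d $ e * (L d e * x) = z $ d $ e * x" for d e x
    using L_01[of d e] by auto
  \<comment> \<open>Testing orthogonality against the indicator of one row, and below of one column,
    shows that \<open>z\<close> has zero row and column sums.\<close>
  have row: "(\<Sum>e\<in>UNIV. z $ d $ e) = 0" for d
    using ortho[of "\<lambda>d'. of_bool (d' = d)" "\<lambda>_. 0"] by (simp add: mask flip: sum_distrib_right)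
  have col: "(\<Sum>d\<in>UNIV. z $ d $ e) = 0" for e
    using ortho[of "\<lambda>_. 0" "\<lambda>e'. of_bool (e' = e)"] by (simp add: mask)
  have pne: "p d \<noteq> 0" for d using p_pos[of d] by simp
  \<comment> \<open>Dividing row \<open>d\<close> of \<open>z\<close> by \<open>p d\<close> gives a
    feasible direction, as the column constraint is weighted by \<open>p\<close>. Stationarity then
    says that \<open>z\<close> is orthogonal to \<open>w\<close>; being orthogonal to
    \<open>u\<close> as well, \<open>z\<close> is orthogonal to itself.\<close>
  have "(\<Sum>d\<in>UNIV. \<Sum>e\<in>UNIV. p d * (z $ d $ e / p d) * ln (Q d e)) = 0"
    by (rule entropy_max_stationary[OF max pos])
      (use zL row col pne in \<open>simp_all flip: sum_divide_distrib\<close>)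
  then have "inner z w = 0"
    using pne by (simp add: inner_vec_def w_def mask)
  moreover have "inner z u = 0" using z[OF u] by (simp add: orthogonal_def)
  ultimately have "z = 0" using w by (simp add: inner_add_right)
  then have "w \<in> U" using w uU by simp
  then obtain a b where ab: "\<And>d e. w $ d $ e = L d e * (a d + b e)" by (auto simp: U_def)
  then have "ln (Q d e) = a d + b e" if "L d e = 1" for d e
    using ab[of d e] that by (simp add: w_def)
  then show ?thesis by (rule that)
qed

end

section \<open>Flows and circulations on a strongly connected graph\<close>

text \<open>\<open>F\<close> is a unit flow from \<open>a\<close> to \<open>b\<close>, counting how
  often a path uses each edge. Appending the edge from \<open>b\<close> to \<open>c\<close> adds one
  unit there and moves the sink to \<open>c\<close>.\<close>

lemma path_flow:
  fixes r :: "'a::finite \<Rightarrow> 'a \<Rightarrow> bool"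
  assumes "r\<^sup>*\<^sup>* a b"
  shows "\<exists>F :: 'a \<Rightarrow> 'a \<Rightarrow> real. (\<forall>x y. 0 \<le> F x y) \<and> (\<forall>x y. \<not> r x y \<longrightarrow> F x y = 0) \<and>
    (\<forall>v. (\<Sum>w\<in>UNIV. F v w) - (\<Sum>w\<in>UNIV. F w v) = of_bool (v = a) - of_bool (v = b))"
  using assms
proof induction
  case base
  show ?case by (intro exI[of _ "\<lambda>_ _. 0"]) simp
next
  case (step b c)
  then obtain F :: "'a \<Rightarrow> 'a \<Rightarrow> real" where F: "\<And>x y. 0 \<le> F x y" "\<And>x y. \<not> r x y \<Longrightarrow> F x y = 0"
    "\<And>v. (\<Sum>w\<in>UNIV. F v w) - (\<Sum>w\<in>UNIV. F w v) = of_bool (v = a) - of_bool (v = b)"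
    by blast
  have "(\<Sum>w\<in>UNIV. F v w + of_bool (v = b) * of_bool (w = c))
      - (\<Sum>w\<in>UNIV. F w v + of_bool (w = b) * of_bool (v = c))
    = of_bool (v = a) - of_bool (v = c)" for v
    using F(3)[of v] by (simp add: sum.distrib flip: sum_distrib_left sum_distrib_right)
  then show ?case
    using F(1,2) step.hyps(2)
    by (intro exI[of _ "\<lambda>x y. F x y + of_bool (x = b) * of_bool (y = c)"]) auto
qed

text \<open>Each edge is closed into a cycle by a unit flow from its head back to its tail; the sum
  of these cycles over all edges is balanced and charges every edge.\<close>

lemma positive_circulation:
  fixes r :: "'a::finite \<Rightarrow> 'a \<Rightarrow> bool"
  assumes "\<And>a b. r\<^sup>*\<^sup>* a b"
  obtains F :: "'a \<Rightarrow> 'a \<Rightarrow> real"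
  where "\<And>x y. 0 \<le> F x y" "\<And>x y. 0 < F x y \<longleftrightarrow> r x y"
    "\<And>v. (\<Sum>w\<in>UNIV. F v w) = (\<Sum>w\<in>UNIV. F w v)"
proof -
  \<comment> \<open>The flow \<open>G a b\<close> runs backwards, from \<open>b\<close> to
    \<open>a\<close>, to close the edge from \<open>a\<close> to \<open>b\<close>.\<close>
  have "\<exists>G :: 'a \<Rightarrow> 'a \<Rightarrow> 'a \<Rightarrow> 'a \<Rightarrow> real. \<forall>a b. (\<forall>x y. 0 \<le> G a b x y) \<and>
    (\<forall>x y. \<not> r x y \<longrightarrow> G a b x y = 0) \<and>
    (\<forall>v. (\<Sum>w\<in>UNIV. G a b v w) - (\<Sum>w\<in>UNIV. G a b w v) = of_bool (v = b) - of_bool (v = a))"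
    by (intro choice allI path_flow assms)
  then obtain G :: "'a \<Rightarrow> 'a \<Rightarrow> 'a \<Rightarrow> 'a \<Rightarrow> real" where G: "\<And>a b x y. 0 \<le> G a b x y"
    "\<And>a b x y. \<not> r x y \<Longrightarrow> G a b x y = 0"
    "\<And>a b v. (\<Sum>w\<in>UNIV. G a b v w) - (\<Sum>w\<in>UNIV. G a b w v) = of_bool (v = b) - of_bool (v = a)"
    by blast
  define E where "E a b = (of_bool (r a b) :: real)" for a b
  define F where "F x y = E x y + (\<Sum>a\<in>UNIV. \<Sum>b\<in>UNIV. E a b * G a b x y)" for x y
  have nonneg: "0 \<le> (\<Sum>a\<in>UNIV. \<Sum>b\<in>UNIV. E a b * G a b x y)" for x y
    by (intro sum_nonneg) (simp add: E_def G)
  have swap: "(\<Sum>w\<in>UNIV. \<Sum>a\<in>UNIV. \<Sum>b\<in>UNIV. E a b * g a b w) = (\<Sum>a\<in>UNIV. \<Sum>b\<in>UNIV. E a b * (\<Sum>w\<in>UNIV. g a b w))"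
    for g :: "'a \<Rightarrow> 'a \<Rightarrow> 'a \<Rightarrow> real"
    unfolding sum_distrib_left
    by (subst sum.swap, rule sum.cong[OF refl], subst sum.swap, rule refl)
  have "(\<Sum>w\<in>UNIV. F v w) - (\<Sum>w\<in>UNIV. F w v)
    = (\<Sum>w\<in>UNIV. E v w) - (\<Sum>w\<in>UNIV. E w v)
      + (\<Sum>a\<in>UNIV. \<Sum>b\<in>UNIV. E a b * ((\<Sum>w\<in>UNIV. G a b v w) - (\<Sum>w\<in>UNIV. G a b w v)))" for v
    unfolding F_def sum.distrib swap by (simp add: right_diff_distrib sum_subtractf)
  \<comment> \<open>The edges contribute out-degree minus in-degree at \<open>v\<close>, and the
    return flows contribute the negative of this.\<close>
  also have "\<dots> v = 0" for v
    unfolding G(3) by (simp add: right_diff_distrib sum_subtractf flip: sum_distrib_right)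
  finally have bal: "(\<Sum>w\<in>UNIV. F v w) = (\<Sum>w\<in>UNIV. F w v)" for v by simp
  show ?thesis
  proof (rule that[OF _ _ bal])
    show "0 \<le> F x y" for x y using nonneg[of x y] by (simp add: F_def E_def)
    show "0 < F x y \<longleftrightarrow> r x y" for x y
      using nonneg[of x y] G(2)[of x y] by (auto simp: F_def E_def)
  qed
qed

section \<open>Full support from a full diagonal, and the scaling equations\<close>

context support_pattern
begin

lemma fully_feasible_of_diagonal:
  assumes irr: "irreducible_mat L" and diag: "\<And>d. L d d = 1"
  shows "fully_feasible L p"
proof -
  obtain F :: "'e \<Rightarrow> 'e \<Rightarrow> real" where F: "\<And>x y. 0 \<le> F x y" "\<And>x y. 0 < F x y \<longleftrightarrow> 0 < L x y"
    "\<And>v. (\<Sum>w\<in>UNIV. F v w) = (\<Sum>w\<in>UNIV. F w v)"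
    using positive_circulation[of "\<lambda>x y. 0 < L x y"] irr unfolding irreducible_mat_def by blast
  define s where "s v = (\<Sum>w\<in>UNIV. F v w)" for v
  have s0: "0 \<le> s v" for v unfolding s_def by (intro sum_nonneg F)
  \<comment> \<open>The summand 1 in the denominator keeps it positive and makes
    \<open>\<epsilon> * s v < p v\<close> strict.\<close>
  define \<epsilon> where "\<epsilon> = Min (range (\<lambda>v. p v / (1 + s v)))"
  have \<epsilon>: "0 < \<epsilon>"
    unfolding \<epsilon>_def using p_pos s0 by (subst Min_gr_iff) (auto intro!: divide_pos_pos add_pos_nonneg)
  have small: "\<epsilon> * s v < p v" for v
  proof -
    have "\<epsilon> \<le> p v / (1 + s v)" unfolding \<epsilon>_def by (intro Min_le) auto
    then have "\<epsilon> * (1 + s v) \<le> p v" using s0[of v] by (simp add: pos_le_divide_eq)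
    then show ?thesis using \<epsilon> by (simp add: distrib_left)
  qed
  \<comment> \<open>\<open>X\<close> holds the joint weights \<open>p d * Q d e\<close>, so both
    marginals must equal \<open>p\<close>. The diagonal gives up exactly the mass that the
    circulation carries through each state.\<close>
  define X where "X d e = of_bool (d = e) * (p d - \<epsilon> * s d) + \<epsilon> * F d e" for d e
  have row: "(\<Sum>e\<in>UNIV. X d e) = p d" for d
    by (simp add: X_def sum.distrib s_def flip: sum_distrib_left sum_distrib_right)
  have col: "(\<Sum>d\<in>UNIV. X d e) = p e" for e
    by (simp add: X_def sum.distrib s_def F(3) flip: sum_distrib_left)
  have zero: "X d e = 0" if "L d e = 0" for d e
    using that diag[of d] F(1,2)[of d e] by (auto simp: X_def)
  have pos: "0 < X d e" if "L d e = 1" for d e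
    using that F(2)[of d e] \<epsilon> small[of d] by (auto simp: X_def intro!: add_pos_pos)
  have pne: "p d \<noteq> 0" for d using p_pos[of d] by simp
  have nonneg: "0 \<le> X d e" for d e
    using L_01[of d e] zero pos by (metis less_imp_le order_refl)
  have "admissible L p (\<lambda>d e. X d e / p d)"
    using nonneg zero row col pne p_pos
    by (auto simp: adm_iff simp flip: sum_divide_distrib intro!: divide_nonneg_pos)
  then show ?thesis
    using pos p_pos by (auto simp: fully_feasible_def intro!: exI[of _ "\<lambda>d e. X d e / p d"])
qed

text \<open>Exponentiating the multipliers gives \<alpha> and \<beta>; the row and column
  constraints become products with nonzero values \<open>1\<close> and \<open>p e\<close>, so the
  sums can be divided out.\<close>

lemma entropy_max_scaling_form:
  assumes max: "is_arg_max (weighted_entropy p) (admissible L p) Q"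
    and pos: "\<And>d e. L d e = 1 \<Longrightarrow> 0 < Q d e"
  shows "\<exists>\<alpha> \<beta>. (\<forall>d. 0 < \<alpha> d) \<and> (\<forall>e. 0 < \<beta> e) \<and>
    (\<forall>d e. Q d e = \<alpha> d * \<beta> e * of_bool (e \<in> row_supp L d)) \<and>
    (\<forall>e. \<beta> e = p e / (\<Sum>d\<in>col_supp L e. p d * (1 / (\<Sum>c\<in>row_supp L d. \<beta> c)))) \<and>
    (\<forall>d. \<alpha> d = 1 / (\<Sum>e\<in>row_supp L d. \<beta> e))"
proof -
  have adm: "admissible L p Q" using max by (simp add: is_arg_max_def)
  obtain a b where ab: "\<And>d e. L d e = 1 \<Longrightarrow> ln (Q d e) = a d + b e"
    using entropy_max_product_form[OF max pos] by blast
  define \<alpha> where "\<alpha> d = exp (a d)" for d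
  define \<beta> where "\<beta> e = exp (b e)" for e
  have Q: "Q d e = \<alpha> d * \<beta> e" if "L d e = 1" for d e
    using ab[OF that] pos[OF that] by (metis \<alpha>_def \<beta>_def exp_add exp_ln)
  have "\<alpha> d * (\<Sum>e\<in>row_supp L d. \<beta> e) = (\<Sum>e\<in>row_supp L d. Q d e)" for d
    unfolding sum_distrib_left by (intro sum.cong) (auto simp: row_supp_def Q)
  then have prod: "\<alpha> d * (\<Sum>e\<in>row_supp L d. \<beta> e) = 1" for d
    using adm by (simp add: admissible_def)
  then have \<alpha>: "\<alpha> d = 1 / (\<Sum>e\<in>row_supp L d. \<beta> e)" for d
    by (metis mult_zero_right nonzero_eq_divide_eq zero_neq_one)
  have "\<beta> e * (\<Sum>d\<in>col_supp L e. p d * \<alpha> d) = (\<Sum>d\<in>col_supp L e. p d * Q d e)" for e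
    unfolding sum_distrib_left by (intro sum.cong) (auto simp: col_supp_def Q)
  then have prod': "\<beta> e * (\<Sum>d\<in>col_supp L e. p d * \<alpha> d) = p e" for e
    using adm by (simp add: admissible_def)
  have \<beta>: "\<beta> e = p e / (\<Sum>d\<in>col_supp L e. p d * \<alpha> d)" for e
    using prod'[of e] p_pos[of e] by (metis less_irrefl mult_zero_right nonzero_eq_divide_eq)
  show ?thesis
  proof (rule exI[of _ \<alpha>], rule exI[of _ \<beta>], intro conjI allI)
    show "Q d e = \<alpha> d * \<beta> e * of_bool (e \<in> row_supp L d)" for d e
      using Q[of d e] L_01[of d e] adm by (auto simp: row_supp_def adm_iff)
    show "\<beta> e = p e / (\<Sum>d\<in>col_supp L e. p d * (1 / (\<Sum>c\<in>row_supp L d. \<beta> c)))" for e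
      unfolding \<alpha>[symmetric] by (rule \<beta>)
  next
    show "0 < \<alpha> d" "0 < \<beta> e" for d e by (simp_all add: \<alpha>_def \<beta>_def)
  qed (rule \<alpha>)
qed

end

section \<open>The stationary chain and the entropy of its completions\<close>

text \<open>Some state has positive mass because the total is 1, and stationarity carries positivity
  along each step of a path.\<close>

lemma stationary_distribution_pos:
  assumes "stochastic P" "irreducible_mat P" "stationary_distribution P \<pi>"
  shows "0 < \<pi> a"
proof -
  have nn: "0 \<le> \<pi> x" "0 \<le> P x y" for x y
    using assms by (auto simp: stochastic_def stationary_distribution_def)
  have "\<exists>z. \<pi> z \<noteq> 0"
  proof (rule ccontr)
    assume "\<not> ?thesis"
    then have "(\<Sum>z\<in>UNIV. \<pi> z) = 0" by simp
    then show False using assms(3) by (simp add: stationary_distribution_def)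
  qed
  then obtain z where z: "0 < \<pi> z" using nn by (metis order_less_le)
  have "(\<lambda>x y. 0 < P x y)\<^sup>*\<^sup>* z a" using assms(2) by (simp add: irreducible_mat_def)
  then show ?thesis
  proof induction
    case (step x y)
    have "0 < \<pi> x * P x y" using step by simp
    also have "\<dots> \<le> (\<Sum>w\<in>UNIV. \<pi> w * P w y)"
      by (rule member_le_sum[of x UNIV "\<lambda>w. \<pi> w * P w y"]) (auto simp: nn)
    also have "\<dots> = \<pi> y" using assms(3) by (simp add: stationary_distribution_def)
    finally show ?case .
  qed (rule z)
qed

lemma sum_UNIV_Plus:
  "(\<Sum>x\<in>UNIV. f x) = (\<Sum>a\<in>UNIV. f (Inl a)) + (\<Sum>b\<in>UNIV. f (Inr b))"
  for f :: "'a::finite + 'b::finite \<Rightarrow> 'c::comm_monoid_add"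
  by (simp add: UNIV_Plus_UNIV[symmetric] sum.Plus del: UNIV_Plus_UNIV)

text \<open>One factor \<open>mass_E \<pi>\<close> comes from rescaling the block, the other from
  normalising the weights to \<open>pi_hat \<pi>\<close>. So entropy and weighted entropy have the
  same maximisers.\<close>

lemma chain_entropy_completion:
  fixes P :: "'i::finite + 'e::finite \<Rightarrow> 'i + 'e \<Rightarrow> real"
  assumes mass: "0 < mass_E \<pi>"
  obtains c where "\<And>Q. (\<And>d e. 0 \<le> Q d e) \<Longrightarrow> (\<And>d. (\<Sum>e\<in>UNIV. Q d e) = 1) \<Longrightarrow>
    chain_entropy \<pi> (completion \<pi> P Q) = c + (mass_E \<pi>)\<^sup>2 * weighted_entropy (pi_hat \<pi>) Q"
proof
  let ?m = "mass_E \<pi>"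
  fix Q :: "'e \<Rightarrow> 'e \<Rightarrow> real"
  assume Q: "\<And>d e. 0 \<le> Q d e" "\<And>d. (\<Sum>e\<in>UNIV. Q d e) = 1"
  have entry: "?m * Q d e * ln (?m * Q d e) = ?m * ln ?m * Q d e + ?m * (Q d e * ln (Q d e))" for d e
    using mass Q(1)[of d e] by (cases "Q d e = 0") (auto simp: ln_mult algebra_simps)
  have row: "(\<Sum>e\<in>UNIV. ?m * Q d e * ln (?m * Q d e)) = ?m * ln ?m + ?m * (\<Sum>e\<in>UNIV. Q d e * ln (Q d e))" for d
    by (simp add: entry sum.distrib Q(2) flip: sum_distrib_left)
  have "?m\<^sup>2 * weighted_entropy (pi_hat \<pi>) Q = - (\<Sum>d\<in>UNIV. \<pi> (Inr d) * (?m * (\<Sum>e\<in>UNIV. Q d e * ln (Q d e))))"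
    using mass by (simp add: weighted_entropy_def pi_hat_def sum_distrib_left power2_eq_square field_simps)
  \<comment> \<open>All but the last summand form \<open>c\<close>: the rows in \<open>I\<close>,
    and for rows in \<E> the known entries plus the term \<open>?m * ln ?m\<close> due to rescaling
    a row of sum 1.\<close>
  then show "chain_entropy \<pi> (completion \<pi> P Q) =
     - (\<Sum>i\<in>UNIV. \<pi> (Inl i) * (\<Sum>b\<in>UNIV. P (Inl i) b * ln (P (Inl i) b)))
     - (\<Sum>d\<in>UNIV. \<pi> (Inr d) * ((\<Sum>i\<in>UNIV. P (Inr d) (Inl i) * ln (P (Inr d) (Inl i))) + ?m * ln ?m))
     + ?m\<^sup>2 * weighted_entropy (pi_hat \<pi>) Q"
    unfolding chain_entropy_def
    by (simp add: sum_UNIV_Plus row distrib_left sum.distrib)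
qed

text \<open>Under \<open>feasible\<close> alone the unique maximiser may vanish at an entry allowed
  by \<open>L\<close>, which excludes a positive scaling. The scaling form is therefore tied to
  \<open>fully_feasible\<close> by an equivalence, and a full diagonal is shown to yield this
  stronger property.\<close>

theorem theorem3p3:
  fixes P :: "'i::finite + 'e::finite \<Rightarrow> 'i + 'e \<Rightarrow> real"
    and \<pi> :: "'i + 'e \<Rightarrow> real"
    and L :: "'e \<Rightarrow> 'e \<Rightarrow> real"
  assumes "stochastic P"
    and "irreducible_mat P"
    and "stationary_distribution P \<pi>"
    and "irreducible_mat (\<lambda>i j. P (Inl i) (Inl j))"
    and "\<exists>i. (\<Sum>d\<in>UNIV. P (Inl i) (Inr d)) > 0"
    and "\<And>d i. P (Inr d) (Inl i) = \<pi> (Inl i)"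
    and "\<And>e. mass_E \<pi> * \<pi> (Inr e) = (\<Sum>d\<in>UNIV. \<pi> (Inr d) * P (Inr d) (Inr e))"
    and "\<And>d e. L d e = 0 \<or> L d e = 1"
    and "irreducible_mat L"
  shows "(feasible L (pi_hat \<pi>) \<longrightarrow>
           (\<exists>Q. (\<forall>R. max_entropy_completion \<pi> P L R \<longleftrightarrow> R = Q) \<and>
             (fully_feasible L (pi_hat \<pi>) \<longleftrightarrow>
               irreducible_mat Q \<and>
               (\<exists>\<alpha> \<beta>.
                 (\<forall>d. 0 < \<alpha> d) \<and> (\<forall>e. 0 < \<beta> e) \<and>
                 (\<forall>d e. Q d e = \<alpha> d * \<beta> e * of_bool (e \<in> row_supp L d)) \<and>
                 (\<forall>e. \<beta> e = pi_hat \<pi> e /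
                    (\<Sum>d\<in>col_supp L e. pi_hat \<pi> d * (1 / (\<Sum>c\<in>row_supp L d. \<beta> c)))) \<and>
                 (\<forall>d. \<alpha> d = 1 / (\<Sum>e\<in>row_supp L d. \<beta> e))))))
       \<and> ((\<forall>d. L d d = 1) \<longrightarrow> feasible L (pi_hat \<pi>) \<and> fully_feasible L (pi_hat \<pi>))"
proof -
  let ?p = "pi_hat \<pi>"
  have \<pi>: "0 < \<pi> a" for a using stationary_distribution_pos assms(1-3) by blast
  have mass: "0 < mass_E \<pi>" unfolding mass_E_def by (intro sum_pos) (auto simp: \<pi>)
  interpret support_pattern L ?p
    by unfold_locales (use assms(8) \<pi> mass in \<open>auto simp: pi_hat_def\<close>)
  obtain c where c: "\<And>Q. (\<And>d e. 0 \<le> Q d e) \<Longrightarrow> (\<And>d. (\<Sum>e\<in>UNIV. Q d e) = 1) \<Longrightarrow>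
    chain_entropy \<pi> (completion \<pi> P Q) = c + (mass_E \<pi>)\<^sup>2 * weighted_entropy ?p Q"
    using chain_entropy_completion[OF mass] by blast
  have "chain_entropy \<pi> (completion \<pi> P R) < chain_entropy \<pi> (completion \<pi> P Q) \<longleftrightarrow>
      weighted_entropy ?p R < weighted_entropy ?p Q"
    if "admissible L ?p R" "admissible L ?p Q" for R Q
    using that mass by (simp add: adm_iff c)
  then have max_iff: "max_entropy_completion \<pi> P L Q \<longleftrightarrow>
      is_arg_max (weighted_entropy ?p) (admissible L ?p) Q" for Q
    unfolding max_entropy_completion_def is_arg_max_def by blast
  show ?thesis
  proof (intro conjI impI)
    assume "feasible L ?p"
    then obtain Q where Q: "is_arg_max (weighted_entropy ?p) (admissible L ?p) Q"
      and uniq: "\<And>R. is_arg_max (weighted_entropy ?p) (admissible L ?p) R \<Longrightarrow> R = Q"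
      using ex1_entropy_max by (metis (no_types))
    show "\<exists>Q. (\<forall>R. max_entropy_completion \<pi> P L R \<longleftrightarrow> R = Q) \<and>
             (fully_feasible L (pi_hat \<pi>) \<longleftrightarrow>
               irreducible_mat Q \<and>
               (\<exists>\<alpha> \<beta>.
                 (\<forall>d. 0 < \<alpha> d) \<and> (\<forall>e. 0 < \<beta> e) \<and>
                 (\<forall>d e. Q d e = \<alpha> d * \<beta> e * of_bool (e \<in> row_supp L d)) \<and>
                 (\<forall>e. \<beta> e = pi_hat \<pi> e /
                    (\<Sum>d\<in>col_supp L e. pi_hat \<pi> d * (1 / (\<Sum>c\<in>row_supp L d. \<beta> c)))) \<and>
                 (\<forall>d. \<alpha> d = 1 / (\<Sum>e\<in>row_supp L d. \<beta> e))))"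
      (is "\<exists>Q. ?unique Q \<and> (?full \<longleftrightarrow> irreducible_mat Q \<and> ?scaling Q)")
    proof (intro exI conjI)
      show "?unique Q" using Q uniq max_iff by blast
      show "?full \<longleftrightarrow> irreducible_mat Q \<and> ?scaling Q"
      proof
        assume ?full
        then have pos: "\<And>d e. L d e = 1 \<Longrightarrow> 0 < Q d e" by (rule entropy_max_pos[OF Q])
        \<comment> \<open>Every edge of \<open>L\<close> is an edge of \<open>Q\<close>, so
          \<open>Q\<close> inherits irreducibility.\<close>
        have "(\<lambda>x y. 0 < Q x y)\<^sup>*\<^sup>* a b" for a b
        proof -
          have "(\<lambda>x y. 0 < L x y)\<^sup>*\<^sup>* a b" using assms(9) by (simp add: irreducible_mat_def)
          then show ?thesis
            by (rule rtranclp_mono[THEN predicate2D, rotated]) (use pos L_01 in force)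
        qed
        moreover have "?scaling Q" by (rule entropy_max_scaling_form[OF Q pos])
        ultimately show "irreducible_mat Q \<and> ?scaling Q" by (simp add: irreducible_mat_def)
      next
        \<comment> \<open>Conversely, positive factors make \<open>Q\<close> itself the fully
          supported admissible matrix.\<close>
        assume "irreducible_mat Q \<and> ?scaling Q"
        then obtain \<alpha> \<beta> where "\<forall>d. 0 < \<alpha> d" "\<forall>e. 0 < \<beta> e"
          "\<forall>d e. Q d e = \<alpha> d * \<beta> e * of_bool (e \<in> row_supp L d)"
          by (elim conjE exE)
        then have "\<forall>d e. L d e = 1 \<longrightarrow> 0 < Q d e" by (simp add: row_supp_def)
        then show ?full using Q by (auto simp: fully_feasible_def is_arg_max_def)
      qed
    qed
  next
    assume "\<forall>d. L d d = 1"
    then show full: "fully_feasible L ?p" using assms(9) by (simp add: fully_feasible_of_diagonal)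
    then show "feasible L ?p" by (auto simp: feasible_def fully_feasible_def)
  qed
qed

end
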